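(* Let $0<q<1$ be real, and let $k$ and $n$ be positive integers. For an integer $j$ put $[j]_q=\frac{1-q^j}{1-q}$, $[j]_{q^2}=\frac{1-q^{2j}}{1-q^2}$ and $[2]_q=1+q$. Define $$G_{n,k,q}=\frac{1-q^2}{(1-q)^{n}}\sum_{m=1}^{n}\binom{n}{m}\frac{(-1)^{m-1}\,m\,q^{\,m+k+\frac{(n-1)(k-1)}{2}-2}}{\bigl(1+q^{\,m-2-\frac{n-1}{2}}\bigr)\bigl(1+q^{\,m-\frac{n-1}{2}}\bigr)}$$ and $$G_{n,k,q}(k)=\frac{1}{(1-q)^{n}}\sum_{m=1}^{n}\binom{n}{m}(-1)^{m+k}\left(\frac{m\,q^{(m-1)k}}{1+q^{\,m-2-\frac{n-1}{2}}}-\frac{m\,q^{(m+1)k}}{1+q^{\,m-\frac{n-1}{2}}}\right),$$ where all fractional powers of $q$ are the positive real ones. Then $$\sum_{j=0}^{k-1}[j]_{q^2}\,(-1)^{j-1}\,[j]_q^{\,n-1}\,q^{\frac{(k-j)(n+1)}{2}}=\frac{G_{n,k,q}-G_{n,k,q}(k)}{n\,[2]_q}.$$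
   Context: $G_{n,k,q}$ and $G_{n,k,q}(k)$ are the paper's $q$-Genocchi numbers; the paper introduces them as the coefficients of $t^n/n!$ in $[2]_q t\sum_{j\ge0}q^{k-j}[j]_{q^2}(-1)^{j-1}\exp\bigl(t[j]_q q^{(k-j)/2}\bigr)$ and $[2]_q t\sum_{j\ge0}q^{-j}[j+k]_{q^2}(-1)^{j+k-1}\exp\bigl(t[j+k]_q q^{-j/2}\bigr)$ respectively, evaluating the sums over $j$ formally via $\sum_{j\ge0}(-1)^jx^j=\frac1{1+x}$; the closed forms above are the resulting values. *)

theory Defs
  imports Complex_Main
begin

definition q_number :: "real \<Rightarrow> int \<Rightarrow> real" where
  "q_number q j = (1 - q powi j) / (1 - q)"

lemma q_number_2: "0 < q \<Longrightarrow> q < 1 \<Longrightarrow> q_number q 2 = 1 + q"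
  by (simp add: q_number_def field_simps power2_eq_square)

lemma q_number_square: "q_number (q^2) j = (1 - q powi (2 * j)) / (1 - q^2)"
  by (simp add: q_number_def power_int_mult)

(* The q-Genocchi numbers are introduced by generating series in t (coefficients of t^n/n!)
   involving sums over j that are divergent and evaluated formally by
   sum_j (-1)^j x^j = 1/(1+x).  The definitions below are the resulting closed forms.  Fractional
   powers of q are the positive real ones, hence powr (only used for q > 0).  Natural-number
   differences m - 1 occur only with m >= 1; all other differences are taken in the reals. *)

definition q_genocchi :: "nat \<Rightarrow> nat \<Rightarrow> real \<Rightarrow> real" where
  "q_genocchi n k q =
     (1 - q^2) / (1 - q)^n *
     (\<Sum>m=1..n. real (n choose m) *
        ((-1)^(m - 1) * real m *
           q powr (real m + real k + (real n - 1) * (real k - 1) / 2 - 2)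
         / ((1 + q powr (real m - 2 - (real n - 1) / 2)) *
            (1 + q powr (real m - (real n - 1) / 2)))))"

(* G_{n,k,q}(k): the argument of the polynomial coincides with the index k. *)
definition q_genocchi_at :: "nat \<Rightarrow> nat \<Rightarrow> real \<Rightarrow> real" where
  "q_genocchi_at n k q =
     1 / (1 - q)^n *
     (\<Sum>m=1..n. real (n choose m) * (-1)^(m + k) *
        (real m * q^((m - 1) * k) / (1 + q powr (real m - 2 - (real n - 1) / 2))
         - real m * q^((m + 1) * k) / (1 + q powr (real m - (real n - 1) / 2))))"

end

theory Submission
  imports Defs
begin

text \<open>Expanding \<open>[j]_q ^ (n - 1)\<close> by the binomial theorem turns the left-hand side into a double
  sum over \<open>m\<close> and \<open>j\<close>. For fixed \<open>m\<close> the sum over \<open>j\<close> is the difference of two finite alternating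
  geometric sums with ratios \<open>x = q powr (m - 2 - (n - 1) / 2)\<close> and \<open>y = q\<^sup>2 * x\<close>. In the closed
  forms \<open>(1 - (- x) ^ k) / (1 + x)\<close> and \<open>(1 - (- y) ^ k) / (1 + y)\<close> the constant terms combine to
  the \<open>m\<close>-th summand of \<^const>\<open>q_genocchi\<close>, and the \<open>k\<close>-th powers give that of \<^const>\<open>q_genocchi_at\<close>.\<close>

text \<open>Absorption \<open>n * (n - 1 choose m - 1) = m * (n choose m)\<close> applied to the
  binomial expansion; equivalently, the negated derivative of \<open>(1 - x) ^ n\<close>. It is the
  source of the factor \<open>m\<close> and of the range starting at 1 in both Genocchi
  sums.\<close>

lemma weighted_binomial_sum:
  fixes x :: real
  assumes "n \<ge> 1"
  shows "real n * (1 - x) ^ (n - 1)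
         = (\<Sum>m=1..n. real (n choose m) * real m * (-1) ^ (m - 1) * x ^ (m - 1))"
proof -
  obtain N where n: "n = Suc N"
    using assms by (cases n) auto
  have absorb: "real n * real (N choose m) = real (n choose Suc m) * real (Suc m)" for m
    unfolding n by (metis Suc_times_binomial mult.commute of_nat_mult)
  have "(1 - x) ^ N = (\<Sum>m\<le>N. real (N choose m) * (- x) ^ m)"
    using binomial_ring[of "- x" 1 N] by simp
  then have "real n * (1 - x) ^ N
      = (\<Sum>m\<le>N. real (n choose Suc m) * real (Suc m) * (-1) ^ m * x ^ m)"
    by (simp add: sum_distrib_left mult.assoc[symmetric] absorb power_minus[of x])
  also have "\<dots> = (\<Sum>m=1..n. real (n choose m) * real m * (-1) ^ (m - 1) * x ^ (m - 1))"
    unfolding n One_nat_def sum.atLeast_Suc_atMost_Suc_shift by (simp add: atLeast0AtMost)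
  finally show ?thesis
    by (simp add: n)
qed

lemma alternating_geometric_sum:
  fixes x :: real
  assumes "1 + x \<noteq> 0"
  shows "(\<Sum>j<k. (-1) ^ j * x ^ j) = (1 - (-1) ^ k * x ^ k) / (1 + x)"
  using sum_gp_strict[of "- x" k] assms by (simp add: power_minus[of x])

text \<open>The exponent of \<open>q\<close> in the weight is affine in \<open>j\<close>, so each
  summand is a constant times a difference of \<open>j\<close>-th powers. This is the contribution
  of one fixed binomial index \<open>m\<close>.\<close>

lemma q_genocchi_summand:
  fixes q :: real and k m n :: nat
  assumes q: "0 < q" and "m \<ge> 1"
  defines "x \<equiv> q powr (real m - 2 - (real n - 1) / 2)"
    and "y \<equiv> q powr (real m - (real n - 1) / 2)"
    and "e \<equiv> real m + real k + (real n - 1) * (real k - 1) / 2 - 2"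
  shows "(\<Sum>j<k. (1 - (q ^ j)\<^sup>2) * (- ((-1) ^ j)) * (q ^ j) ^ (m - 1) *
            q powr ((real k - real j) * (real n + 1) / 2))
         = (1 - q\<^sup>2) * q powr e / ((1 + x) * (1 + y))
           + (-1) ^ k * (q ^ ((m - 1) * k) / (1 + x) - q ^ ((m + 1) * k) / (1 + y))"
    (is "?lhs = _")
proof -
  \<comment> \<open>The weight at \<open>j = 0\<close>.\<close>
  define B where "B = q powr (real k * (real n + 1) / 2)"
  have pos: "0 < x" "0 < y"
    using q by (simp_all add: x_def y_def)
  have "q\<^sup>2 = q powr 2"
    using q by simp
  then have yx: "y = q\<^sup>2 * x"
    by (simp only: x_def y_def flip: powr_add) simp
  have x_pow: "(q ^ j) ^ (m - 1) * q powr ((real k - real j) * (real n + 1) / 2) = B * x ^ j" for j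
  proof -
    \<comment> \<open>The coefficient of \<open>j\<close> is \<open>m - 1 - (n + 1) / 2\<close>,
      which equals the exponent \<open>m - 2 - (n - 1) / 2\<close> of \<open>x\<close>.\<close>
    have e: "real j * (real m - 1) + (real k - real j) * (real n + 1) / 2
        = real k * (real n + 1) / 2 + (real m - 2 - (real n - 1) / 2) * real j"
      by (simp add: field_simps)
    have "(q ^ j) ^ (m - 1) = q powr (real j * (real m - 1))"
      using q assms(2) by (simp add: of_nat_diff powr_powr flip: powr_realpow)
    moreover have "x ^ j = q powr ((real m - 2 - (real n - 1) / 2) * real j)"
      using q by (simp add: x_def powr_powr flip: powr_realpow)
    ultimately show ?thesis
      by (simp add: B_def e flip: powr_add)
  qed
  have y_pow: "(q ^ j)\<^sup>2 * x ^ j = y ^ j" for j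
    by (simp add: yx power_mult_distrib mult.commute flip: power_mult)
  have "(1 - (q ^ j)\<^sup>2) * (- ((-1) ^ j)) * (q ^ j) ^ (m - 1) *
            q powr ((real k - real j) * (real n + 1) / 2)
      = B * ((-1) ^ j * y ^ j - (-1) ^ j * x ^ j)" for j
    unfolding mult.assoc x_pow y_pow[symmetric] by (simp add: algebra_simps)
  then have "?lhs = B * ((\<Sum>j<k. (-1) ^ j * y ^ j) - (\<Sum>j<k. (-1) ^ j * x ^ j))"
    by (simp only: sum_distrib_left flip: sum_subtractf)
  also have "\<dots> = B * ((1 - (-1) ^ k * y ^ k) / (1 + y) - (1 - (-1) ^ k * x ^ k) / (1 + x))"
    using pos by (simp add: alternating_geometric_sum)
  also have "\<dots> = B * (1 / (1 + y) - 1 / (1 + x))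
      + (-1) ^ k * (B * x ^ k / (1 + x) - B * y ^ k / (1 + y))"
    by (simp add: algebra_simps diff_divide_distrib)
  \<comment> \<open>The numerator is \<open>x - y\<close>, and \<open>y\<close> is
    \<open>q\<^sup>2 * x\<close>.\<close>
  also have "1 / (1 + y) - 1 / (1 + x) = (1 - q\<^sup>2) * x / ((1 + x) * (1 + y))"
    using pos by (simp add: divide_simps) (simp add: yx algebra_simps)
  also have "B * ((1 - q\<^sup>2) * x / ((1 + x) * (1 + y)))
      = (1 - q\<^sup>2) * (B * x) / ((1 + x) * (1 + y))"
    by simp
  also have "B * x = q powr e"
    unfolding B_def x_def e_def powr_add[symmetric]
    by (rule arg_cong[where f = "(powr) q"]) (simp add: field_simps)
  \<comment> \<open>At \<open>j = k\<close> the weight is \<open>q powr 0\<close>, so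
    \<open>x_pow\<close> gives the value directly.\<close>
  also have Bx: "B * x ^ k = q ^ ((m - 1) * k)"
    using x_pow[of k] q by (simp add: mult.commute flip: power_mult)
  also have "B * y ^ k = q ^ ((m + 1) * k)"
  proof -
    have "B * y ^ k = q ^ (2 * k) * q ^ ((m - 1) * k)"
      unfolding y_pow[symmetric] Bx[symmetric] by (simp add: mult.commute flip: power_mult)
    also have "\<dots> = q ^ ((m + 1) * k)"
      using assms(2) by (simp add: algebra_simps flip: power_add)
    finally show ?thesis .
  qed
  finally show ?thesis .
qed

theorem theorem4:
  fixes q :: real and k n :: nat
  assumes "0 < q" and "q < 1" and "k \<ge> 1" and "n \<ge> 1"
  shows "(\<Sum>j=0..k-1. q_number (q^2) (int j) * (-1) powi (int j - 1) *
            q_number q (int j) ^ (n - 1) *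
            q powr ((real k - real j) * (real n + 1) / 2))
         = (q_genocchi n k q - q_genocchi_at n k q) / (real n * q_number q 2)"
    (is "?lhs = _")
proof -
  define w where "w j = q powr ((real k - real j) * (real n + 1) / 2)" for j :: nat
  define c where "c m = real (n choose m) * real m * (-1) ^ (m - 1)" for m
  define x where "x m = q powr (real m - 2 - (real n - 1) / 2)" for m :: nat
  define y where "y m = q powr (real m - (real n - 1) / 2)" for m :: nat
  define e where "e m = real m + real k + (real n - 1) * (real k - 1) / 2 - 2" for m :: nat
  define M where "M m = (1 - q\<^sup>2) * q powr e m / ((1 + x m) * (1 + y m))" for m
  define P where "P m = q ^ ((m - 1) * k) / (1 + x m) - q ^ ((m + 1) * k) / (1 + y m)" for m
  have sgn: "(-1) powi (int j - 1) = - ((-1) ^ j :: real)" for j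
    by (simp add: power_int_diff)
  have q_pow: "(1 - q) ^ n = (1 - q) * (1 - q) ^ (n - 1)"
    using \<open>n \<ge> 1\<close> by (simp add: power_eq_if)
  \<comment> \<open>The factor \<open>1 + q\<close> cancels against
    \<open>1 - q\<^sup>2 = (1 + q) * (1 - q)\<close>. The remaining \<open>1 - q\<close> raises the
    denominator to the \<open>n\<close>-th power, and \<open>n\<close> stays next to
    \<open>(1 - q ^ j) ^ (n - 1)\<close> for \<open>weighted_binomial_sum\<close>.\<close>
  have summand: "real n * (1 + q) * (q_number (q^2) (int j) * (-1) powi (int j - 1) *
            q_number q (int j) ^ (n - 1) * w j)
      = 1 / (1 - q) ^ n * ((1 - (q ^ j)\<^sup>2) * (- ((-1) ^ j)) * (real n * (1 - q ^ j) ^ (n - 1)) * w j)"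
    for j
  proof -
    have "1 - q\<^sup>2 = (1 + q) * (1 - q)"
      by (simp add: power2_eq_square algebra_simps)
    then have "q_number (q^2) (int j) = (1 - (q ^ j)\<^sup>2) / ((1 + q) * (1 - q))"
      by (simp add: q_number_def mult.commute flip: power_mult)
    then have "(1 + q) * q_number (q^2) (int j) = (1 - (q ^ j)\<^sup>2) / (1 - q)"
      using assms(1) by simp
    moreover have "q_number q (int j) ^ (n - 1) = (1 - q ^ j) ^ (n - 1) / (1 - q) ^ (n - 1)"
      by (simp add: q_number_def power_divide)
    ultimately have "(1 + q) * q_number (q^2) (int j) * q_number q (int j) ^ (n - 1)
        = (1 - (q ^ j)\<^sup>2) * (1 - q ^ j) ^ (n - 1) / (1 - q) ^ n"
      by (simp add: q_pow)
    from arg_cong[OF this, of "\<lambda>t. real n * (- ((-1) ^ j)) * w j * t"] show ?thesis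
      unfolding sgn by (simp add: mult_ac)
  qed
  have "real n * (1 + q) * ?lhs = 1 / (1 - q) ^ n *
      (\<Sum>j<k. (1 - (q ^ j)\<^sup>2) * (- ((-1) ^ j)) * (real n * (1 - q ^ j) ^ (n - 1)) * w j)"
  proof -
    have "{0..k - 1} = {..<k}"
      using \<open>k \<ge> 1\<close> by auto
    then show ?thesis
      unfolding w_def[symmetric] sum_distrib_left summand by simp
  qed
  also have "(\<Sum>j<k. (1 - (q ^ j)\<^sup>2) * (- ((-1) ^ j)) * (real n * (1 - q ^ j) ^ (n - 1)) * w j)
      = (\<Sum>j<k. \<Sum>m=1..n. c m * ((1 - (q ^ j)\<^sup>2) * (- ((-1) ^ j)) * (q ^ j) ^ (m - 1) * w j))"
    unfolding weighted_binomial_sum[OF \<open>n \<ge> 1\<close>] c_def sum_distrib_left sum_distrib_right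
    by (simp add: mult_ac)
  also have "\<dots> = (\<Sum>m=1..n. c m *
      (\<Sum>j<k. (1 - (q ^ j)\<^sup>2) * (- ((-1) ^ j)) * (q ^ j) ^ (m - 1) * w j))"
    by (subst sum.swap) (simp add: sum_distrib_left)
  also have "\<dots> = (\<Sum>m=1..n. c m * (M m + (-1) ^ k * P m))"
    by (intro sum.cong refl arg_cong2[where f = "(*)"])
       (unfold w_def M_def P_def x_def y_def e_def, rule q_genocchi_summand, use \<open>0 < q\<close> in auto)
  also have "\<dots> = (\<Sum>m=1..n. c m * M m) + (\<Sum>m=1..n. c m * ((-1) ^ k * P m))"
    by (simp add: distrib_left sum.distrib)
  also have "1 / (1 - q) ^ n * \<dots> = q_genocchi n k q - q_genocchi_at n k q"
  proof -
    have "1 / (1 - q) ^ n * (\<Sum>m=1..n. c m * M m) = q_genocchi n k q"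
      unfolding q_genocchi_def sum_distrib_left
      by (intro sum.cong refl) (simp add: c_def M_def x_def y_def e_def mult_ac)
    \<comment> \<open>The sign in \<open>c\<close> is \<open>(-1) ^ (m - 1)\<close> but that of
      \<open>q_genocchi_at\<close> is \<open>(-1) ^ (m + k)\<close>; the mismatch by one is the
      minus sign in the theorem.\<close>
    moreover have "(\<Sum>m=1..n. c m * ((-1) ^ k * P m)) = - (\<Sum>m=1..n. real (n choose m) *
        (-1) ^ (m + k) * (real m * q ^ ((m - 1) * k) / (1 + x m)
          - real m * q ^ ((m + 1) * k) / (1 + y m)))"
      unfolding sum_negf[symmetric]
    proof (intro sum.cong refl)
      fix m assume "m \<in> {1..n}"
      then have "(-1) ^ (m + k) = - ((-1) ^ (m - 1) * (-1) ^ k :: real)"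
        by (cases m) (simp_all add: power_add)
      then show "c m * ((-1) ^ k * P m) = - (real (n choose m) * (-1) ^ (m + k) *
          (real m * q ^ ((m - 1) * k) / (1 + x m) - real m * q ^ ((m + 1) * k) / (1 + y m)))"
        by (simp add: c_def P_def right_diff_distrib mult_ac)
    qed
    ultimately show ?thesis
      unfolding distrib_left q_genocchi_at_def x_def y_def by simp
  qed
  finally show ?thesis
    using assms by (simp add: q_number_2 eq_divide_eq mult.commute)
qed

end
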